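(* There is no Dumont permutation (of any length) that contains the pattern $132$ exactly once.
   Context: A permutation $\pi=\pi_1\cdots\pi_n\in S_n$ is a Dumont permutation (of the first kind) if every even entry $\pi_i$ is followed by a smaller entry ($i<n$ and $\pi_{i+1}<\pi_i$) and every odd entry $\pi_i$ is either last ($i=n$) or followed by a larger entry. An occurrence of the (classical) pattern $132$ in $\pi$ is a triple $i<j<l$ with $\pi_i<\pi_l<\pi_j$; $\pi$ contains $132$ exactly once if there is exactly one such triple. *)

theory Defs
  imports "HOL-Combinatorics.Permutations"
begin

text \<open>
  A permutation in \<open>S\<^sub>n\<close> is a function \<open>\<pi>\<close> with \<open>\<pi> permutes {1..n}\<close>; its one-line notation is
  \<open>\<pi> 1, \<dots>, \<pi> n\<close>. Outside \<open>{1..n}\<close> such a \<open>\<pi>\<close> is the identity, so positions are always bounded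
  explicitly. Dumont permutations are those of the first kind.
\<close>

definition dumont_permutation :: "nat \<Rightarrow> (nat \<Rightarrow> nat) \<Rightarrow> bool" where
  "dumont_permutation n \<pi> \<longleftrightarrow>
     \<pi> permutes {1..n} \<and>
     (\<forall>i\<in>{1..n}.
        (even (\<pi> i) \<longrightarrow> i < n \<and> \<pi> (i + 1) < \<pi> i) \<and>
        (odd (\<pi> i) \<longrightarrow> i = n \<or> \<pi> i < \<pi> (i + 1)))"

definition occurrences_132 :: "nat \<Rightarrow> (nat \<Rightarrow> nat) \<Rightarrow> (nat \<times> nat \<times> nat) set" where
  "occurrences_132 n \<pi> =
     {(i, j, l). 1 \<le> i \<and> i < j \<and> j < l \<and> l \<le> n \<and> \<pi> i < \<pi> l \<and> \<pi> l < \<pi> j}"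

definition contains_132_exactly_once :: "nat \<Rightarrow> (nat \<Rightarrow> nat) \<Rightarrow> bool" where
  "contains_132_exactly_once n \<pi> \<longleftrightarrow> card (occurrences_132 n \<pi>) = 1"

end

theory Submission
  imports Defs
begin

text \<open>
  Let \<open>a b c\<close> be the values of the only occurrence of 132. Uniqueness and the Dumont condition make
  \<open>a\<close> odd, \<open>b\<close> even and \<open>c = a + 1\<close>. Hence \<open>b - 1\<close> is odd and exceeds \<open>c\<close>, and by uniqueness it
  stands to the left of \<open>a\<close>. Being odd, it is followed by some larger value, which exceeds \<open>b\<close>;
  these two entries together with \<open>b\<close> form a second occurrence.
\<close>

lemma dumont_no_unique_132:
  assumes D: "dumont_permutation n \<pi>"
    and U: "occurrences_132 n \<pi> = {(i, j, l)}"
  shows False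
proof -
  have perm: "\<pi> permutes {1..n}"
    and ev: "\<And>k. \<lbrakk>1 \<le> k; k \<le> n; even (\<pi> k)\<rbrakk> \<Longrightarrow> k < n \<and> \<pi> (k + 1) < \<pi> k"
    and od: "\<And>k. \<lbrakk>1 \<le> k; k < n; odd (\<pi> k)\<rbrakk> \<Longrightarrow> \<pi> k < \<pi> (k + 1)"
    using D by (auto simp: dumont_permutation_def)
  have inj: "\<pi> x = \<pi> y \<longleftrightarrow> x = y" for x y
    using permutes_inj[OF perm] by (auto dest: injD)
  have pos: "\<exists>p. 1 \<le> p \<and> p \<le> n \<and> \<pi> p = v" if "1 \<le> v" "v \<le> n" for v
    using permutes_image[OF perm] that by (metis atLeastAtMost_iff imageE)
  have range: "1 \<le> \<pi> k" "\<pi> k \<le> n" if "1 \<le> k" "k \<le> n" for k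
    using permutes_in_image[OF perm, of k] that by auto
  have "(i, j, l) \<in> occurrences_132 n \<pi>" using U by simp
  then have ord: "1 \<le> i" "i < j" "j < l" "l \<le> n" and val: "\<pi> i < \<pi> l" "\<pi> l < \<pi> j"
    by (auto simp: occurrences_132_def)
  have uniq: "x = i \<and> y = j \<and> z = l"
    if "1 \<le> x" "x < y" "y < z" "z \<le> n" "\<pi> x < \<pi> z" "\<pi> z < \<pi> y" for x y z
  proof -
    have "(x, y, z) \<in> occurrences_132 n \<pi>" using that by (simp add: occurrences_132_def)
    then show ?thesis using U by simp
  qed
  \<comment> \<open>Otherwise the descent after \<open>i\<close> gives a smaller entry that can
    replace \<open>\<pi> i\<close>; being below \<open>\<pi> i\<close>, it does not stand at
    \<open>j\<close>.\<close>
  have "odd (\<pi> i)"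
  proof
    assume "even (\<pi> i)"
    then have less: "\<pi> (i + 1) < \<pi> i" using ev[of i] ord by simp
    then have "i + 1 \<noteq> j" using val by auto
    then show False using uniq[of "i + 1" j l] ord val less by simp
  qed
  \<comment> \<open>Dually, an ascent after \<open>j\<close> would give a second choice for the
    largest entry.\<close>
  have "even (\<pi> j)"
  proof (rule ccontr)
    assume "odd (\<pi> j)"
    then have less: "\<pi> j < \<pi> (j + 1)" using od[of j] ord by simp
    then have "j + 1 \<noteq> l" using val by auto
    then show False using uniq[of i "j + 1" l] ord val less by simp
  qed
  have "\<pi> l = \<pi> i + 1"
  proof (rule ccontr)
    assume "\<pi> l \<noteq> \<pi> i + 1"
    then have gap: "\<pi> i + 1 < \<pi> l" using val by simp
    moreover have "\<pi> l \<le> n" using range ord by simp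
    ultimately obtain p where p: "1 \<le> p" "p \<le> n" "\<pi> p = \<pi> i + 1"
      using pos[of "\<pi> i + 1"] by auto
    then have ne: "p \<noteq> i" "p \<noteq> j" "p \<noteq> l" using gap val by auto
    \<comment> \<open>Left of \<open>j\<close> the value \<open>\<pi> i + 1\<close> could replace
      \<open>\<pi> i\<close>, right of \<open>j\<close> it could replace
      \<open>\<pi> l\<close>.\<close>
    show False
    proof (cases "p < j")
      case True
      then show ?thesis using uniq[of p j l] ord val p gap ne by simp
    next
      case False
      then show ?thesis using uniq[of i j p] ord val p gap ne by simp
    qed
  qed
  then have "even (\<pi> l)" using \<open>odd (\<pi> i)\<close> by simp
  define v where "v = \<pi> j - 1"
  have vj: "\<pi> j = v + 1" using val by (simp add: v_def)
  have "odd v" using \<open>even (\<pi> j)\<close> vj by simp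
  \<comment> \<open>Parity excludes \<open>v = \<pi> l\<close>.\<close>
  then have lv: "\<pi> l < v" using \<open>even (\<pi> l)\<close> val vj by (metis Suc_eq_plus1 less_SucE)
  obtain p where p: "1 \<le> p" "p \<le> n" "\<pi> p = v"
    using pos[of v] lv range(2)[of j] ord vj by auto
  have ne: "p \<noteq> i" "p \<noteq> j" "p \<noteq> l" using p lv val vj by auto
  \<comment> \<open>Since \<open>\<pi> l < v < \<pi> j\<close>, the entry \<open>v\<close> could
    replace \<open>\<pi> l\<close> if it stood right of \<open>j\<close>, and \<open>\<pi> j\<close>
    if it stood between \<open>i\<close> and \<open>j\<close>.\<close>
  have "\<not> j < p" using uniq[of i j p] ord val vj p lv ne by auto
  moreover have "\<not> (i < p \<and> p < j)" using uniq[of i p l] ord val p lv by auto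
  ultimately have "p < i" using ne by linarith
  then have "v < \<pi> (p + 1)" using od[of p] p \<open>odd v\<close> ord by simp
  \<comment> \<open>An entry above \<open>v\<close> other than \<open>v + 1 = \<pi> j\<close>
    exceeds \<open>\<pi> j\<close>; here \<open>p + 1 \<le> i < j\<close>.\<close>
  moreover have "\<pi> (p + 1) \<noteq> \<pi> j" using inj \<open>p < i\<close> ord by simp
  ultimately have "\<pi> j < \<pi> (p + 1)" using vj by simp
  \<comment> \<open>In this occurrence \<open>\<pi> j\<close> plays the middle value, no longer the
    largest.\<close>
  then show False using uniq[of p "p + 1" j] p \<open>p < i\<close> ord vj by simp
qed

theorem theorem4p1:
  shows "\<not> (\<exists>(n::nat) (\<pi>::nat \<Rightarrow> nat). dumont_permutation n \<pi> \<and> contains_132_exactly_once n \<pi>)"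
proof
  assume "\<exists>(n::nat) (\<pi>::nat \<Rightarrow> nat). dumont_permutation n \<pi> \<and> contains_132_exactly_once n \<pi>"
  then obtain n \<pi> where D: "dumont_permutation n \<pi>" and "card (occurrences_132 n \<pi>) = 1"
    by (auto simp: contains_132_exactly_once_def)
  then obtain i j l where "occurrences_132 n \<pi> = {(i, j, l)}"
    by (metis card_1_singletonE prod_cases3)
  with D show False by (rule dumont_no_unique_132)
qed

end
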